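(* Let $q\in\mathbb{C}[z]$ be monic and of even degree $d$. Then there exists a basis $f_0,\dots,f_n$ of $\mathbb{C}[z]_n$ which is orthonormal with respect to the Fischer inner product $\langle\cdot,\cdot\rangle_n$ and satisfies $$[f_j\circ q,\,f_k\circ q]_{nd}=\lambda_j\delta_{jk}$$ for all $j,k=0,\dots,n$, where $\lambda_0,\dots,\lambda_n$ are the singular values of the operator $T_{q,n}\colon\mathbb{C}[z]_n\to\mathbb{C}[z]_n$ (with respect to the Fischer inner product).
   Context: $\mathbb{C}[z]_m$ is the space of complex polynomials of degree at most $m$. For $f=\sum_{k=0}^m a_kz^k$, $g=\sum_{k=0}^m b_kz^k$ in $\mathbb{C}[z]_m$, the Fischer inner product is $\langle f,g\rangle_m=\sum_{k=0}^m\frac{1}{\binom{m}{k}}a_k\overline{b_k}$. For $f=\sum_{k=0}^m a_kz^k$ regarded as an element of $\mathbb{C}[z]_m$, put $f^\vee(z)=f(-z)$, $f^\#(z)=z^m\overline{f(1/\overline{z})}=\sum_{k=0}^m\overline{a_{m-k}}z^k$ (this depends on $m$), and $f^{\#\vee}=(f^\#)^\vee$. The apolarity form on $\mathbb{C}[z]_m$ is the bilinear form $[f,g]_m=\langle f,g^{\#\vee}\rangle_m$. For $q$ monic of degree $d$ and $f\in\mathbb{C}[z]_n$, define $$S_{q,n}(f)(u_1,\dots,u_n)=\Bigl\langle f\circ q,\ \prod_{j=1}^n(q-u_j)^{\#\vee}\Bigr\rangle_{nd},\qquad T_{q,n}(f)(z)=S_{q,n}(f)(z,\dots,z),$$ where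 each $q-u_j$ is regarded as an element of $\mathbb{C}[z]_d$ when forming $(q-u_j)^{\#\vee}$. The singular values of a linear operator $T$ are the eigenvalues (with multiplicity) of $|T|=\sqrt{T^\ast T}$. *)

theory Defs
  imports "HOL-Computational_Algebra.Computational_Algebra" Complex_Main
begin

global_interpretation cpoly: vector_space "smult :: complex \<Rightarrow> complex poly \<Rightarrow> complex poly"
  by unfold_locales (simp_all add: smult_add_right smult_add_left)

definition poly_space :: "nat \<Rightarrow> complex poly set" where
  "poly_space m = {f. degree f \<le> m}"

definition fischer :: "nat \<Rightarrow> complex poly \<Rightarrow> complex poly \<Rightarrow> complex" where
  "fischer m f g = (\<Sum>k\<le>m. coeff f k * cnj (coeff g k) / of_nat (m choose k))"

definition vee :: "complex poly \<Rightarrow> complex poly" where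
  "vee f = pcompose f [:0, -1:]"

definition sharp :: "nat \<Rightarrow> complex poly \<Rightarrow> complex poly" where
  "sharp m f = (\<Sum>k\<le>m. monom (cnj (coeff f (m - k))) k)"

definition sharpvee :: "nat \<Rightarrow> complex poly \<Rightarrow> complex poly" where
  "sharpvee m f = vee (sharp m f)"

definition apolar :: "nat \<Rightarrow> complex poly \<Rightarrow> complex poly \<Rightarrow> complex" where
  "apolar m f g = fischer m f (sharpvee m g)"

text \<open>The operations below are used for monic \<open>q\<close>, and the degree \<open>d\<close> is \<open>degree q\<close>.\<close>

definition S_op :: "complex poly \<Rightarrow> nat \<Rightarrow> complex poly \<Rightarrow> (nat \<Rightarrow> complex) \<Rightarrow> complex" where
  "S_op q n f u = fischer (n * degree q) (pcompose f q)
     (\<Prod>j\<in>{1..n}. sharpvee (degree q) (q - [:u j:]))"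

text \<open>\<open>T_op q n f\<close> is the polynomial whose polynomial function is
  \<open>z \<mapsto> S_op q n f (z, \<dots>, z)\<close>; \<open>poly_T_op\<close> and \<open>degree_T_op_le\<close> show that it exists and
  has degree at most \<open>n\<close>.\<close>

definition T_op :: "complex poly \<Rightarrow> nat \<Rightarrow> complex poly \<Rightarrow> complex poly" where
  "T_op q n f = (THE p. \<forall>z. poly p z = S_op q n f (\<lambda>_. z))"

definition operator_on :: "nat \<Rightarrow> (complex poly \<Rightarrow> complex poly) \<Rightarrow> bool" where
  "operator_on n A \<longleftrightarrow>
     (\<forall>f\<in>poly_space n. A f \<in> poly_space n) \<and>
     (\<forall>f\<in>poly_space n. \<forall>g\<in>poly_space n. A (f + g) = A f + A g) \<and>
     (\<forall>c. \<forall>f\<in>poly_space n. A (smult c f) = smult c (A f))"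

definition adjoint_on ::
    "nat \<Rightarrow> (complex poly \<Rightarrow> complex poly) \<Rightarrow> (complex poly \<Rightarrow> complex poly) \<Rightarrow> bool" where
  "adjoint_on n A B \<longleftrightarrow> operator_on n B \<and>
     (\<forall>f\<in>poly_space n. \<forall>g\<in>poly_space n. fischer n (A f) g = fischer n f (B g))"

definition positive_on :: "nat \<Rightarrow> (complex poly \<Rightarrow> complex poly) \<Rightarrow> bool" where
  "positive_on n A \<longleftrightarrow> adjoint_on n A A \<and>
     (\<forall>f\<in>poly_space n. fischer n (A f) f \<in> \<real> \<and> 0 \<le> Re (fischer n (A f) f))"

text \<open>\<open>P\<close> is the modulus of \<open>A\<close>, i.e. the positive square root of \<open>A\<^sup>* A\<close>.  Adjoint and modulus
  are relations because operators are determined only on \<open>poly_space n\<close>, not outside it.\<close>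

definition modulus_on ::
    "nat \<Rightarrow> (complex poly \<Rightarrow> complex poly) \<Rightarrow> (complex poly \<Rightarrow> complex poly) \<Rightarrow> bool" where
  "modulus_on n A P \<longleftrightarrow> positive_on n P \<and>
     (\<exists>B. adjoint_on n A B \<and> (\<forall>f\<in>poly_space n. P (P f) = B (A f)))"

text \<open>\<open>sv 0, \<dots>, sv n\<close> enumerates the eigenvalues of the modulus of \<open>A\<close>, each as often as the
  dimension of its eigenspace.  The modulus is self-adjoint, so geometric and algebraic
  multiplicities agree.\<close>

definition singular_values_on ::
    "nat \<Rightarrow> (complex poly \<Rightarrow> complex poly) \<Rightarrow> (nat \<Rightarrow> real) \<Rightarrow> bool" where
  "singular_values_on n A sv \<longleftrightarrow> operator_on n A \<and>
     (\<exists>P. modulus_on n A P \<and>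
       (\<forall>\<mu>::complex. card {j. j \<le> n \<and> complex_of_real (sv j) = \<mu>}
          = cpoly.dim {f \<in> poly_space n. P f = smult \<mu> f}))"

definition basis_on :: "nat \<Rightarrow> (nat \<Rightarrow> complex poly) \<Rightarrow> bool" where
  "basis_on n f \<longleftrightarrow> inj_on f {..n} \<and> cpoly.independent (f ` {..n}) \<and>
     cpoly.span (f ` {..n}) = poly_space n"

definition orthonormal_on :: "nat \<Rightarrow> (nat \<Rightarrow> complex poly) \<Rightarrow> bool" where
  "orthonormal_on n f \<longleftrightarrow>
     (\<forall>j\<le>n. \<forall>k\<le>n. fischer n (f j) (f k) = (if j = k then 1 else 0))"


lemma coeff_sharp: "coeff (sharp m f) k = (if k \<le> m then cnj (coeff f (m - k)) else 0)"
  by (auto simp: sharp_def coeff_sum coeff_monom)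

lemma poly_sharp:
  assumes "degree f \<le> m" and "z \<noteq> 0"
  shows "poly (sharp m f) z = z ^ m * cnj (poly f (1 / cnj z))"
proof -
  have "poly f (1 / cnj z) = (\<Sum>k\<le>m. coeff f k * (1 / cnj z) ^ k)"
    unfolding poly_altdef
    using assms(1) by (intro sum.mono_neutral_left) (auto simp: coeff_eq_0)
  hence "z ^ m * cnj (poly f (1 / cnj z)) = (\<Sum>k\<le>m. z ^ m * (cnj (coeff f k) * (1 / z) ^ k))"
    by (simp add: sum_distrib_left)
  also have "\<dots> = (\<Sum>k\<le>m. cnj (coeff f k) * z ^ (m - k))"
    using assms(2) by (intro sum.cong) (auto simp: power_diff field_simps)
  also have "\<dots> = (\<Sum>k\<le>m. cnj (coeff f (m - k)) * z ^ k)"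
    by (rule sum.reindex_bij_witness[of _ "\<lambda>k. m - k" "\<lambda>k. m - k"]) auto
  also have "\<dots> = poly (sharp m f) z"
    by (simp add: sharp_def poly_sum poly_monom)
  finally show ?thesis by simp
qed

lemma sharpvee_diff_const:
  "sharpvee m (f - [:z:]) = sharpvee m f + smult (cnj z) (- sharpvee m 1)"
proof -
  have *: "sharp m (f - [:z:]) = sharp m f - smult (cnj z) (sharp m 1)"
    by (rule poly_eqI) (auto simp: coeff_sharp coeff_pCons split: nat.splits)
  show ?thesis
    by (simp add: sharpvee_def vee_def * pcompose_diff pcompose_smult)
qed

lemma fischer_sum_right: "fischer m f (\<Sum>i\<in>I. g i) = (\<Sum>i\<in>I. fischer m f (g i))"
  unfolding fischer_def coeff_sum cnj_sum sum_distrib_left sum_divide_distrib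
  by (rule sum.swap)

lemma fischer_smult_right: "fischer m f (smult c g) = cnj c * fischer m f g"
  by (simp add: fischer_def sum_distrib_left mult_ac)

lemma T_op_exists: "\<exists>p\<in>poly_space n. \<forall>z. poly p z = S_op q n f (\<lambda>_. z)"
proof -
  define m A B where "m = n * degree q" and "A = sharpvee (degree q) q"
    and "B = - sharpvee (degree q) 1"
  define c where "c k = fischer m (pcompose f q) (of_nat (n choose k) * B ^ k * A ^ (n - k))" for k
  define p where "p = (\<Sum>k\<le>n. monom (c k) k)"
  have "S_op q n f (\<lambda>_. z) = poly p z" for z
  proof -
    have "S_op q n f (\<lambda>_. z) = fischer m (pcompose f q) ((smult (cnj z) B + A) ^ n)"
      by (simp add: S_op_def m_def A_def B_def sharpvee_diff_const add.commute)
    also have "(smult (cnj z) B + A) ^ n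
        = (\<Sum>k\<le>n. smult (cnj (z ^ k)) (of_nat (n choose k) * B ^ k * A ^ (n - k)))"
      unfolding binomial_ring by (simp add: smult_power)
    finally show ?thesis
      by (simp add: fischer_sum_right fischer_smult_right p_def poly_sum poly_monom c_def mult.commute)
  qed
  moreover have "p \<in> poly_space n"
    unfolding p_def poly_space_def
    by (auto intro!: degree_sum_le order.trans[OF degree_monom_le])
  ultimately show ?thesis by auto
qed

lemma T_op_spec: "T_op q n f \<in> poly_space n \<and> (\<forall>z. poly (T_op q n f) z = S_op q n f (\<lambda>_. z))"
proof -
  obtain p where p: "p \<in> poly_space n" "\<forall>z. poly p z = S_op q n f (\<lambda>_. z)"
    using T_op_exists by blast
  have "T_op q n f = p"
    unfolding T_op_def
  proof (rule the_equality)
    fix p' assume "\<forall>z. poly p' z = S_op q n f (\<lambda>_. z)"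
    with p(2) have "poly p' = poly p" by (intro ext) simp
    thus "p' = p" by (simp add: poly_eq_poly_eq_iff)
  qed (use p in auto)
  with p show ?thesis by simp
qed

lemma poly_T_op: "poly (T_op q n f) z = S_op q n f (\<lambda>_. z)"
  using T_op_spec by blast

lemma degree_T_op_le: "degree (T_op q n f) \<le> n"
  using T_op_spec by (simp add: poly_space_def)

end

theory Submission
  imports Defs "HOL-Analysis.Analysis"
begin

text \<open>
  Write \<open>J\<close> for the antiunitary map \<open>h \<mapsto> h\<^sup>#\<^sup>\<or>\<close> of \<open>\<complex>[z]\<^sub>n\<close> and \<open>T\<close> for \<open>T\<^sub>q\<^sub>,\<^sub>n\<close>.  Since
  \<open>T f (z) = [f \<circ> q, (q - z)\<^sup>n]\<close>, expanding \<open>(q - z)\<^sup>n\<close> gives the coefficients of \<open>T f\<close>, and hence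
  \<open>\<langle>T f, J h\<rangle>\<^sub>n = [f \<circ> q, h \<circ> q]\<close>.  As \<open>n d\<close> is even, the right-hand side is a symmetric bilinear form
  in \<open>f\<close> and \<open>h\<close>, so Takagi's theorem provides an orthonormal basis in which it is diagonal with
  entries \<open>s\<^sub>j \<ge> 0\<close>.  Then \<open>T f\<^sub>j = s\<^sub>j J f\<^sub>j\<close>, and as \<open>J\<close> maps the basis to an orthonormal one,
  \<open>T\<^sup>* T f\<^sub>j = s\<^sub>j\<^sup>2 f\<^sub>j\<close>: the \<open>s\<^sub>j\<close> are the singular values of \<open>T\<close>.
\<close>

section \<open>Takagi factorisation of a symmetric bilinear form\<close>

text \<open>Vectors are total functions whose values outside \<open>I\<close> are ignored, so
  \<open>herm\<close> is definite only up to those values.\<close>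

definition herm :: "'a set \<Rightarrow> ('a \<Rightarrow> complex) \<Rightarrow> ('a \<Rightarrow> complex) \<Rightarrow> complex" where
  "herm I x y = (\<Sum>i\<in>I. x i * cnj (y i))"

definition bilf :: "'a set \<Rightarrow> ('a \<Rightarrow> 'a \<Rightarrow> complex) \<Rightarrow> ('a \<Rightarrow> complex) \<Rightarrow> ('a \<Rightarrow> complex) \<Rightarrow> complex" where
  "bilf I M x y = (\<Sum>a\<in>I. \<Sum>b\<in>I. M a b * x a * y b)"

lemma herm_add_left: "herm I (\<lambda>i. x i + y i) z = herm I x z + herm I y z"
  by (simp add: herm_def sum.distrib algebra_simps)

lemma herm_diff_left: "herm I (\<lambda>i. x i - y i) z = herm I x z - herm I y z"
  by (simp add: herm_def sum_subtractf algebra_simps)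

lemma herm_scale_left: "herm I (\<lambda>i. c * x i) z = c * herm I x z"
  by (simp add: herm_def sum_distrib_left mult_ac)

lemma herm_sum_left: "herm I (\<lambda>i. \<Sum>j\<in>J. x j i) z = (\<Sum>j\<in>J. herm I (x j) z)"
  unfolding herm_def sum_distrib_right by (rule sum.swap)

lemma herm_commute: "herm I y x = cnj (herm I x y)"
  by (simp add: herm_def mult.commute)

lemma herm_add_right: "herm I z (\<lambda>i. x i + y i) = herm I z x + herm I z y"
  by (simp add: herm_def sum.distrib algebra_simps)

lemma herm_scale_right: "herm I z (\<lambda>i. c * x i) = cnj c * herm I z x"
  by (simp add: herm_def sum_distrib_left mult_ac)

lemma herm_self: "herm I x x = complex_of_real (\<Sum>i\<in>I. (cmod (x i))\<^sup>2)"
  by (simp only: herm_def of_real_sum complex_norm_square)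

lemma herm_self_eq_0_iff: "finite I \<Longrightarrow> herm I x x = 0 \<longleftrightarrow> (\<forall>i\<in>I. x i = 0)"
  unfolding herm_self of_real_eq_0_iff by (subst sum_nonneg_eq_0_iff) auto

lemma herm_cong: "(\<And>i. i \<in> I \<Longrightarrow> x i = x' i) \<Longrightarrow> (\<And>i. i \<in> I \<Longrightarrow> y i = y' i) \<Longrightarrow> herm I x y = herm I x' y'"
  by (simp add: herm_def)

lemma bilf_cong: "(\<And>i. i \<in> I \<Longrightarrow> x i = x' i) \<Longrightarrow> (\<And>i. i \<in> I \<Longrightarrow> y i = y' i) \<Longrightarrow> bilf I M x y = bilf I M x' y'"
  by (simp add: bilf_def)

lemma bilf_add_left: "bilf I M (\<lambda>i. x i + y i) z = bilf I M x z + bilf I M y z"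
  by (simp add: bilf_def sum.distrib algebra_simps)

lemma bilf_add_right: "bilf I M z (\<lambda>i. x i + y i) = bilf I M z x + bilf I M z y"
  by (simp add: bilf_def sum.distrib algebra_simps)

lemma bilf_scale_left: "bilf I M (\<lambda>i. c * x i) z = c * bilf I M x z"
  by (simp add: bilf_def sum_distrib_left mult_ac)

lemma bilf_scale_right: "bilf I M z (\<lambda>i. c * x i) = c * bilf I M z x"
  by (simp add: bilf_def sum_distrib_left mult_ac)

lemma bilf_commute:
  assumes "\<And>a b. a \<in> I \<Longrightarrow> b \<in> I \<Longrightarrow> M a b = M b a"
  shows "bilf I M x y = bilf I M y x"
  unfolding bilf_def
  by (subst sum.swap) (intro sum.cong refl, simp add: assms mult_ac)

section \<open>Orthonormal families in coordinate space\<close>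

definition orthonormal_family :: "'a set \<Rightarrow> nat \<Rightarrow> (nat \<Rightarrow> 'a \<Rightarrow> complex) \<Rightarrow> bool" where
  "orthonormal_family I k u \<longleftrightarrow> (\<forall>i<k. \<forall>j<k. herm I (u i) (u j) = (if i = j then 1 else 0))"

text \<open>The component of the unit vector at \<open>a\<close> orthogonal to \<open>u 0, \<dots>, u (k - 1)\<close>.\<close>

definition residual :: "'a set \<Rightarrow> nat \<Rightarrow> (nat \<Rightarrow> 'a \<Rightarrow> complex) \<Rightarrow> 'a \<Rightarrow> 'a \<Rightarrow> complex" where
  "residual I k u a = (\<lambda>i. (if i = a then 1 else 0) - (\<Sum>j<k. cnj (u j a) * u j i))"

lemma herm_unit_left:
  assumes "finite I" "a \<in> I"
  shows "herm I (\<lambda>i. if i = a then 1 else 0) y = cnj (y a)"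
  using assms by (simp add: herm_def if_distrib[of "\<lambda>x. x * _"] cong: if_cong)

lemma herm_residual:
  assumes "finite I" "a \<in> I" "orthonormal_family I k u" "j < k"
  shows "herm I (residual I k u a) (u j) = 0"
proof -
  have "(\<Sum>l<k. cnj (u l a) * herm I (u l) (u j)) = (\<Sum>l<k. if l = j then cnj (u j a) else 0)"
    using assms(3,4) by (intro sum.cong) (auto simp: orthonormal_family_def)
  thus ?thesis
    using assms unfolding residual_def
    by (simp add: herm_diff_left herm_sum_left herm_scale_left herm_unit_left)
qed

text \<open>Pythagoras: the residual is orthogonal to every \<open>u j\<close>, so its squared norm
  is its pairing with the unit vector alone, that is, its own value at \<open>a\<close>.\<close>

lemma herm_residual_self:
  assumes "finite I" "a \<in> I" "orthonormal_family I k u"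
  shows "herm I (residual I k u a) (residual I k u a)
    = complex_of_real (1 - (\<Sum>j<k. (cmod (u j a))\<^sup>2))"
proof -
  let ?r = "residual I k u a"
  have "herm I ?r ?r = cnj (?r a) - (\<Sum>j<k. cnj (u j a) * herm I (u j) ?r)"
    by (subst (1) residual_def)
      (simp add: herm_diff_left herm_sum_left herm_scale_left herm_unit_left[OF assms(1,2)])
  also have "(\<Sum>j<k. cnj (u j a) * herm I (u j) ?r) = 0"
    using herm_residual[OF assms] by (intro sum.neutral) (simp add: herm_commute[of _ "u _"])
  finally show ?thesis
    by (simp add: residual_def of_real_diff of_real_sum complex_norm_square mult.commute del: of_real_power)
qed

text \<open>The double sum is the trace of the projection onto the span of the family; summing over
  \<open>a\<close> first gives the squared norms of the \<open>u j\<close>.\<close>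

lemma sum_orthonormal_family:
  assumes "orthonormal_family I k u"
  shows "(\<Sum>a\<in>I. \<Sum>j<k. (cmod (u j a))\<^sup>2) = real k"
proof -
  have "complex_of_real (\<Sum>a\<in>I. \<Sum>j<k. (cmod (u j a))\<^sup>2) = (\<Sum>j<k. herm I (u j) (u j))"
    by (subst sum.swap) (simp add: herm_self)
  also have "\<dots> = complex_of_real (real k)"
    using assms by (simp add: orthonormal_family_def)
  finally show ?thesis by (simp only: of_real_eq_iff)
qed

text \<open>Some residual serves as \<open>x\<close>. If all of them vanished, the projection would
  have every diagonal entry 1, and its trace \<open>k\<close> would equal \<open>card I\<close>.
  This count replaces a dimension argument.\<close>

lemma orthonormal_family_extend:
  assumes "finite I" "orthonormal_family I k u" "k < card I"
  shows "\<exists>x. herm I x x \<noteq> 0 \<and> (\<forall>j<k. herm I x (u j) = 0)"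
proof (rule ccontr)
  assume "\<not> ?thesis"
  hence "herm I (residual I k u a) (residual I k u a) = 0" if "a \<in> I" for a
    using herm_residual[OF assms(1) that assms(2)] by blast
  hence "complex_of_real (1 - (\<Sum>j<k. (cmod (u j a))\<^sup>2)) = 0" if "a \<in> I" for a
    using herm_residual_self[OF assms(1) that assms(2)] that by metis
  hence "(\<Sum>j<k. (cmod (u j a))\<^sup>2) = 1" if "a \<in> I" for a
    using that unfolding of_real_eq_0_iff by fastforce
  thus False using sum_orthonormal_family[OF assms(2)] assms(3) by simp
qed

text \<open>A square matrix with orthonormal rows has orthonormal columns: the squared norms of the
  residuals are nonnegative and sum to \<open>card I - card I = 0\<close>, so every residual
  vanishes.\<close>

lemma orthonormal_family_complete:
  assumes fin: "finite I" and u: "orthonormal_family I (card I) u" and "a \<in> I" "i \<in> I"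
  shows "(\<Sum>j<card I. cnj (u j a) * u j i) = (if i = a then 1 else 0)"
proof -
  let ?s = "\<lambda>a. (\<Sum>j<card I. (cmod (u j a))\<^sup>2)" and ?r = "residual I (card I) u"
  have r: "complex_of_real (1 - ?s b) = complex_of_real (\<Sum>i\<in>I. (cmod (?r b i))\<^sup>2)" if "b \<in> I" for b
    using herm_residual_self[OF fin that u] herm_self by metis
  have "0 \<le> 1 - ?s b" if "b \<in> I" for b
    using r[OF that] unfolding of_real_eq_iff by (simp add: sum_nonneg)
  moreover have "(\<Sum>b\<in>I. 1 - ?s b) = 0"
    by (simp add: sum_subtractf sum_orthonormal_family[OF u])
  ultimately have "1 - ?s a = 0"
    using sum_nonneg_eq_0_iff[OF fin, of "\<lambda>b. 1 - ?s b"] \<open>a \<in> I\<close> by blast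
  hence "herm I (?r a) (?r a) = 0"
    using herm_residual_self[OF fin \<open>a \<in> I\<close> u] by simp
  hence "?r a i = 0"
    using herm_self_eq_0_iff[OF fin] \<open>i \<in> I\<close> by blast
  thus ?thesis by (simp add: residual_def)
qed

section \<open>Constrained maximisation of the quadratic form\<close>

lemma maximizer_exists:
  assumes fin: "finite I" and ne: "herm I x0 x0 \<noteq> 0" "\<forall>j<k. herm I x0 (u j) = 0"
  obtains x where "herm I x x = 1" "\<forall>j<k. herm I x (u j) = 0"
    "\<And>y. \<forall>j<k. herm I y (u j) = 0 \<Longrightarrow> Re (bilf I M y y) \<le> Re (bilf I M x x) * Re (herm I y y)"
proof -
  \<comment> \<open>The unit sphere of the orthogonal complement of the family. \<open>PiE\<close>
    fixes the values outside \<open>I\<close>, so the polydisc is a product of discs and singletons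
    over the whole index type, and Tychonoff gives compactness.\<close>
  define K where "K = PiE I (\<lambda>_. cball 0 1) \<inter> {x. herm I x x = 1}
    \<inter> (\<Inter>j\<in>{..<k}. {x. herm I x (u j) = 0})"
  have cont: "continuous_on UNIV (\<lambda>x. x i :: complex)" for i :: 'a
    by (rule continuous_on_product_coordinates)
  have "PiE I (\<lambda>_. cball 0 1) = PiE UNIV (\<lambda>i. if i \<in> I then cball (0::complex) 1 else {undefined})"
    by (auto simp: PiE_iff extensional_def split: if_splits)
  hence "compact (PiE I (\<lambda>_. cball (0::complex) 1))"
    unfolding compactin_euclidean_iff[symmetric] euclidean_product_topology[symmetric]
    by (simp add: compactin_PiE)
  moreover have "closed {x. herm I x x = 1}" "closed {x. herm I x (u j) = 0}" for j
    unfolding herm_def by (intro closed_Collect_eq continuous_intros cont)+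
  ultimately have "compact K"
    unfolding K_def by (intro compact_Int_closed closed_INT) auto
  \<comment> \<open>Dividing \<open>y\<close> by its norm and restricting to \<open>I\<close> gives
    a point of \<open>K\<close>. The factor \<open>c\<close> is real, so both forms scale by the
    same \<open>c\<^sup>2\<close>, which extends the bound on \<open>K\<close> to the whole
    complement.\<close>
  have normalise: "\<exists>z\<in>K. bilf I M y y = herm I y y * bilf I M z z"
    if y: "herm I y y \<noteq> 0" "\<forall>j<k. herm I y (u j) = 0" for y
  proof -
    define r where "r = (\<Sum>i\<in>I. (cmod (y i))\<^sup>2)"
    have r: "herm I y y = of_real r" "r > 0"
      using y(1) unfolding herm_self of_real_eq_0_iff by (auto simp: r_def sum_nonneg less_le)
    define c where "c = complex_of_real (1 / sqrt r)"
    have c: "c * cnj c * of_real r = 1" "c\<^sup>2 * of_real r = 1"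
      using r(2) by (auto simp: c_def power2_eq_square simp flip: of_real_mult)
    define z where "z = restrict (\<lambda>i. c * y i) I"
    have h: "herm I z w = c * herm I y w" for w
      by (simp add: z_def herm_scale_left[symmetric] cong: herm_cong)
    have zz: "herm I z z = 1"
      using c(1) h[of z] h[of y] r(1) herm_commute[of I y z] by (simp add: mult_ac)
    have "cmod (z i) \<le> 1" if "i \<in> I" for i
    proof -
      have "(\<Sum>i\<in>I. (cmod (z i))\<^sup>2) = 1"
        using zz unfolding herm_self by (simp only: of_real_eq_1_iff)
      hence "(cmod (z i))\<^sup>2 \<le> 1"
        using member_le_sum[OF that, of "\<lambda>i. (cmod (z i))\<^sup>2"] fin by simp
      thus ?thesis by (simp add: power2_le_iff_abs_le abs_square_le_1)
    qed
    hence "z \<in> K"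
      unfolding K_def using y(2) zz by (auto simp: h) (auto simp: z_def)
    moreover have "bilf I M z z = c\<^sup>2 * bilf I M y y"
      by (simp add: z_def bilf_scale_left bilf_scale_right power2_eq_square cong: bilf_cong)
    hence "bilf I M y y = herm I y y * bilf I M z z"
      using c(2) r(1) by (simp add: mult_ac)
    ultimately show ?thesis by blast
  qed
  have "K \<noteq> {}" using normalise[OF ne] by blast
  moreover have "continuous_on K (\<lambda>x. Re (bilf I M x x))"
    unfolding bilf_def
    by (intro continuous_intros continuous_on_subset[OF cont]) auto
  ultimately obtain x where x: "x \<in> K" "\<And>z. z \<in> K \<Longrightarrow> Re (bilf I M z z) \<le> Re (bilf I M x x)"
    using continuous_attains_sup[OF \<open>compact K\<close>] by blast
  show ?thesis
  proof (rule that[of x])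
    fix y assume y: "\<forall>j<k. herm I y (u j) = 0"
    show "Re (bilf I M y y) \<le> Re (bilf I M x x) * Re (herm I y y)"
    proof (cases "herm I y y = 0")
      case True
      hence "bilf I M y y = 0"
        unfolding herm_self_eq_0_iff[OF fin] by (simp add: bilf_def)
      with True show ?thesis by simp
    next
      case False
      then obtain z where "z \<in> K" "bilf I M y y = herm I y y * bilf I M z z"
        using normalise y by blast
      thus ?thesis
        using x(2)[of z] by (simp add: herm_self mult.commute sum_nonneg mult_right_mono)
    qed
  qed (use x(1) in \<open>auto simp: K_def\<close>)
qed

text \<open>Comparing \<open>x\<close> with its multiples by unit scalars shows that the maximum is \<open>\<bar>b(x, x)\<bar>\<close>; comparing
  it with \<open>x + t w\<^sup>* y\<close>, \<open>w = b(x, y)\<close>, the term of first order in \<open>t\<close> gives \<open>b(x, y) = 0\<close>.\<close>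

lemma maximizer_singular:
  assumes sym: "\<And>a b. a \<in> I \<Longrightarrow> b \<in> I \<Longrightarrow> M a b = M b a"
    and x: "herm I x x = 1" "\<forall>j<k. herm I x (u j) = 0"
    and max: "\<And>y. \<forall>j<k. herm I y (u j) = 0 \<Longrightarrow> Re (bilf I M y y) \<le> Re (bilf I M x x) * Re (herm I y y)"
  defines "s \<equiv> Re (bilf I M x x)"
  shows "s \<ge> 0" "bilf I M x x = of_real s"
    "\<And>y. \<forall>j<k. herm I y (u j) = 0 \<Longrightarrow> herm I y x = 0 \<Longrightarrow> bilf I M x y = 0"
proof -
  define b where "b = bilf I M x x"
  have scaled: "Re (c\<^sup>2 * b) \<le> s * (cmod c)\<^sup>2" for c
  proof -
    have "c * cnj c = of_real ((cmod c)\<^sup>2)" by (simp only: complex_norm_square)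
    thus ?thesis
      using max[of "\<lambda>i. c * x i"] x
      by (simp add: herm_scale_left herm_scale_right bilf_scale_left bilf_scale_right
          s_def b_def power2_eq_square mult_ac)
  qed
  \<comment> \<open>For \<open>c = \<i>\<close> the inequality reads
    \<open>- s \<le> s\<close>.\<close>
  show "s \<ge> 0" using scaled[of \<i>] by (simp add: s_def b_def)
  have "cmod b \<le> s"
  proof (cases "b = 0")
    case False
    \<comment> \<open>A unit scalar that rotates \<open>b\<close> to its absolute value:
      \<open>c\<^sup>2 * b = cmod b\<close>.\<close>
    define c where "c = csqrt (cnj b / cmod b)"
    have "b * cnj b = of_real ((cmod b)\<^sup>2)"
      by (simp only: complex_norm_square)
    hence "c\<^sup>2 * b = cmod b"
      using False by (simp add: c_def power2_eq_square[of "complex_of_real _"] field_simps)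
    moreover have "(cmod c)\<^sup>2 = 1"
      using False unfolding norm_power[symmetric] c_def power2_csqrt by (simp add: norm_divide)
    ultimately show ?thesis using scaled[of c] by simp
  qed (use \<open>s \<ge> 0\<close> in simp)
  hence "(cmod b)\<^sup>2 \<le> (Re b)\<^sup>2"
    by (intro power_mono) (auto simp: s_def b_def)
  hence "Im b = 0"
    by (simp add: cmod_power2)
  thus "bilf I M x x = of_real s" by (simp add: complex_eq_iff s_def b_def)
  fix y assume y: "\<forall>j<k. herm I y (u j) = 0" "herm I y x = 0"
  define w where "w = bilf I M x y"
  \<comment> \<open>Collects the terms of order \<open>t\<^sup>2\<close> when the maximality of
    \<open>x\<close> is tested on \<open>x + t * cnj w * y\<close>; the constant terms
    cancel.\<close>
  define C where "C = s * (cmod w)\<^sup>2 * Re (herm I y y) - Re ((cnj w)\<^sup>2 * bilf I M y y)"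
  have *: "2 * t * (cmod w)\<^sup>2 \<le> t\<^sup>2 * C" for t :: real
  proof -
    define c where "c = of_real t * cnj w"
    let ?z = "\<lambda>i. x i + c * y i"
    have xy: "herm I x y = 0" using y(2) by (simp add: herm_commute[of I x y])
    have cc: "c * cnj c = of_real (t\<^sup>2 * (cmod w)\<^sup>2)" "c\<^sup>2 = of_real (t\<^sup>2) * (cnj w)\<^sup>2"
      "c * w = of_real (t * (cmod w)\<^sup>2)"
      unfolding of_real_mult complex_norm_square by (simp_all add: c_def power2_eq_square)
    have "herm I ?z ?z = 1 + c * cnj c * herm I y y"
      using x(1) y(2) xy by (simp add: herm_add_left herm_add_right herm_scale_left herm_scale_right)
    hence 1: "Re (herm I ?z ?z) = 1 + t\<^sup>2 * (cmod w)\<^sup>2 * Re (herm I y y)"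
      unfolding cc by simp
    have "bilf I M ?z ?z = b + 2 * (c * w) + c\<^sup>2 * bilf I M y y"
      using bilf_commute[OF sym, where x = x and y = y]
      by (simp add: bilf_add_left bilf_add_right bilf_scale_left bilf_scale_right w_def b_def power2_eq_square)
    hence 2: "Re (bilf I M ?z ?z) = s + 2 * t * (cmod w)\<^sup>2 + t\<^sup>2 * Re ((cnj w)\<^sup>2 * bilf I M y y)"
      unfolding cc mult.assoc Re_complex_of_real by (simp add: s_def b_def del: Re_complex_div_gt_0)
    have "\<forall>j<k. herm I ?z (u j) = 0"
      using x(2) y(1) by (simp add: herm_add_left herm_scale_left)
    from max[OF this] show ?thesis
      unfolding 1 2 s_def[symmetric] C_def by (simp add: algebra_simps)
  qed
  have "w = 0"
  proof (rule ccontr)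
    assume "w \<noteq> 0"
    hence "(cmod w)\<^sup>2 > 0" by simp
    \<comment> \<open>The value \<open>t = 1\<close> shows \<open>C > 0\<close>; then
      \<open>t = (cmod w)\<^sup>2 / C\<close> makes the linear term exceed the quadratic one unless
      \<open>w = 0\<close>.\<close>
    moreover have "2 * (cmod w)\<^sup>2 \<le> C" using *[of 1] by simp
    ultimately have "C > 0" by linarith
    hence "(cmod w)\<^sup>2 * (cmod w)\<^sup>2 \<le> 0"
      using *[of "(cmod w)\<^sup>2 / C"] by (simp add: power2_eq_square field_simps)
    thus False using \<open>w \<noteq> 0\<close> by (simp add: mult_le_0_iff)
  qed
  thus "bilf I M x y = 0" by (simp add: w_def)
qed

text \<open>Greedy construction: each new vector maximises \<open>Re (bilf I M x x)\<close> on the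
  unit sphere of the orthogonal complement of its predecessors, and the maximum becomes its diagonal
  entry.\<close>

lemma takagi:
  assumes fin: "finite I" and sym: "\<And>a b. a \<in> I \<Longrightarrow> b \<in> I \<Longrightarrow> M a b = M b a"
  obtains u s where "orthonormal_family I (card I) u" "\<And>j. s j \<ge> 0"
    "\<And>i j. i < card I \<Longrightarrow> j < card I \<Longrightarrow> bilf I M (u i) (u j) = (if i = j then complex_of_real (s j) else 0)"
proof -
  \<comment> \<open>The last conjunct carries the induction: the vectors chosen so far pair to zero
    with their entire orthogonal complement, hence with any vector chosen later.\<close>
  define good where "good k u s \<longleftrightarrow> orthonormal_family I k u \<and> (\<forall>j. s j \<ge> 0) \<and>
    (\<forall>i<k. \<forall>j<k. bilf I M (u i) (u j) = (if i = j then complex_of_real (s j) else 0)) \<and>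
    (\<forall>y. (\<forall>j<k. herm I y (u j) = 0) \<longrightarrow> (\<forall>i<k. bilf I M (u i) y = 0))" for k u s
  have "\<exists>u s. good k u s" if "k \<le> card I" for k
    using that
  proof (induction k)
    case 0
    have "good 0 (\<lambda>_ _. 0) (\<lambda>_. 0)" by (simp add: good_def orthonormal_family_def)
    thus ?case by blast
  next
    case (Suc k)
    then obtain u s where us: "good k u s" by auto
    then obtain x0 where "herm I x0 x0 \<noteq> 0" "\<forall>j<k. herm I x0 (u j) = 0"
      using orthonormal_family_extend[OF fin, of k u] Suc.prems by (auto simp: good_def)
    then obtain x where x: "herm I x x = 1" "\<forall>j<k. herm I x (u j) = 0"
      "\<And>y. \<forall>j<k. herm I y (u j) = 0 \<Longrightarrow> Re (bilf I M y y) \<le> Re (bilf I M x x) * Re (herm I y y)"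
      using maximizer_exists[OF fin] by blast
    note m = maximizer_singular[OF sym x]
    have "herm I (u j) x = 0" if "j < k" for j
      using x(2) that by (simp add: herm_commute[of I "u j" x])
    moreover have "bilf I M (u j) x = 0" "bilf I M x (u j) = 0" if "j < k" for j
      using us x(2) that bilf_commute[OF sym, where x = x and y = "u j"] by (auto simp: good_def)
    ultimately have "good (Suc k) (u(k := x)) (s(k := Re (bilf I M x x)))"
      using us x(1,2) m
      unfolding good_def orthonormal_family_def
      by (auto simp: less_Suc_eq)
    thus ?case by blast
  qed
  from this[OF order.refl] show ?thesis
    using that unfolding good_def by blast
qed

section \<open>The apolarity form and the operator \<open>T_op\<close>\<close>

lemma coeff_sharpvee:
  "coeff (sharpvee m f) k = (if k \<le> m then (-1) ^ k * cnj (coeff f (m - k)) else 0)"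
  by (simp add: sharpvee_def vee_def coeff_pcompose_linear coeff_sharp)

lemma minus_one_power_cancel: "(-1) ^ k * a * ((-1) ^ k * b) = a * b"
  for a b :: complex
  by (cases "even k") simp_all

lemma sharpvee_in_poly_space: "sharpvee m f \<in> poly_space m"
  unfolding poly_space_def by (auto intro!: degree_le simp: coeff_sharpvee)

text \<open>The signs at \<open>k\<close> and \<open>m - k\<close> multiply to
  \<open>(-1) ^ m\<close>, so the map is an involution only up to sign.\<close>

lemma sharpvee_sharpvee:
  assumes "f \<in> poly_space m"
  shows "sharpvee m (sharpvee m f) = smult ((-1) ^ m) f"
proof (rule poly_eqI)
  fix k
  show "coeff (sharpvee m (sharpvee m f)) k = coeff (smult ((-1) ^ m) f) k"
  proof (cases "k \<le> m")
    case True
    then show ?thesis by (simp add: coeff_sharpvee flip: power_add mult.assoc)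
  next
    case False
    then show ?thesis using assms by (simp add: coeff_sharpvee poly_space_def coeff_eq_0)
  qed
qed

lemma sharp_mult:
  assumes "degree f \<le> m" "degree g \<le> k"
  shows "sharp (m + k) (f * g) = sharp m f * sharp k g"
proof -
  \<comment> \<open>The evaluation formula for \<open>sharp\<close> requires
    \<open>z \<noteq> 0\<close>; multiplying both sides by the variable makes the case
    \<open>z = 0\<close> trivial.\<close>
  let ?X = "[:0, 1:] :: complex poly"
  have "degree (f * g) \<le> m + k"
    using assms degree_mult_le[of f g] by linarith
  hence "poly (?X * sharp (m + k) (f * g)) z = poly (?X * (sharp m f * sharp k g)) z" for z
    by (cases "z = 0") (simp_all add: poly_sharp assms power_add)
  hence "?X * sharp (m + k) (f * g) = ?X * (sharp m f * sharp k g)"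
    by (intro poly_ext)
  thus ?thesis by (simp del: mult_pCons_left)
qed

text \<open>Turns the product of reversed factors in \<open>S_op\<close>, on the diagonal, into the
  reversal of a single power, so that \<open>T_op\<close> is expressed by the apolarity
  form.\<close>

lemma sharpvee_power:
  assumes "degree f \<le> d"
  shows "sharpvee (n * d) (f ^ n) = sharpvee d f ^ n"
proof (induction n)
  case 0
  have "sharp 0 1 = 1" by (rule poly_eqI) (simp add: coeff_sharp)
  thus ?case by (simp add: sharpvee_def vee_def pcompose_1)
next
  case (Suc n)
  have "degree (f ^ n) \<le> n * d"
    using degree_power_le[of f n] assms by (metis order.trans mult.commute mult_le_mono2)
  thus ?case
    using Suc assms by (simp add: sharpvee_def vee_def sharp_mult pcompose_mult)
qed

lemma apolar_eq_sum:
  "apolar m f g = (\<Sum>k\<le>m. (-1) ^ k * coeff f k * coeff g (m - k) / of_nat (m choose k))"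
  by (simp add: apolar_def fischer_def coeff_sharpvee mult_ac)

text \<open>Reversing the summation changes the form by the factor \<open>(-1) ^ m\<close>. The even
  degree of \<open>q\<close> enters the theorem through this symmetry.\<close>

lemma apolar_commute:
  assumes "even m"
  shows "apolar m f g = apolar m g f"
proof -
  have "(-1) ^ (m - k) = ((-1) ^ k :: complex)" if "k \<le> m" for k
    using that assms by (simp add: minus_one_power_iff)
  moreover have "apolar m g f = (\<Sum>k\<le>m. (-1) ^ (m - k) * coeff g (m - k) * coeff f k / of_nat (m choose (m - k)))"
    unfolding apolar_eq_sum
    by (rule sum.reindex_bij_witness[of _ "\<lambda>k. m - k" "\<lambda>k. m - k"]) auto
  ultimately show ?thesis
    unfolding apolar_eq_sum by (simp add: mult_ac flip: binomial_symmetric)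
qed

lemma apolar_add_left: "apolar m (f + g) h = apolar m f h + apolar m g h"
  by (simp add: apolar_eq_sum algebra_simps add_divide_distrib sum.distrib)

lemma apolar_smult_left: "apolar m (smult c f) h = c * apolar m f h"
  by (simp add: apolar_eq_sum sum_distrib_left mult_ac)

lemma apolar_add_right: "apolar m h (f + g) = apolar m h f + apolar m h g"
  by (simp add: apolar_eq_sum algebra_simps add_divide_distrib sum.distrib)

lemma apolar_smult_right: "apolar m h (smult c f) = c * apolar m h f"
  by (simp add: apolar_eq_sum sum_distrib_left mult_ac)

lemma apolar_sum_left: "apolar m (\<Sum>i\<in>A. f i) h = (\<Sum>i\<in>A. apolar m (f i) h)"
  by (induction A rule: infinite_finite_induct) (simp_all add: apolar_add_left, simp_all add: apolar_eq_sum)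

lemma apolar_sum_right: "apolar m h (\<Sum>i\<in>A. f i) = (\<Sum>i\<in>A. apolar m h (f i))"
  by (induction A rule: infinite_finite_induct) (simp_all add: apolar_add_right, simp_all add: apolar_eq_sum)

section \<open>The Fischer product as an inner product\<close>

lemma fischer_add_left: "fischer m (f + g) h = fischer m f h + fischer m g h"
  by (simp add: fischer_def algebra_simps add_divide_distrib sum.distrib)

lemma fischer_smult_left: "fischer m (smult c f) h = c * fischer m f h"
  by (simp add: fischer_def sum_distrib_left mult_ac)

lemma fischer_diff_left: "fischer m (f - g) h = fischer m f h - fischer m g h"
  by (simp add: fischer_def algebra_simps diff_divide_distrib sum_subtractf)

lemma fischer_sum_left: "fischer m (\<Sum>i\<in>A. f i) h = (\<Sum>i\<in>A. fischer m (f i) h)"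
  unfolding fischer_def coeff_sum sum_distrib_right sum_divide_distrib by (rule sum.swap)

lemma fischer_commute: "fischer m g f = cnj (fischer m f g)"
  by (simp add: fischer_def mult.commute)

lemma fischer_self:
  "fischer m f f = complex_of_real (\<Sum>k\<le>m. (cmod (coeff f k))\<^sup>2 / real (m choose k))"
  unfolding fischer_def of_real_sum of_real_divide complex_norm_square by simp

lemma fischer_self_eq_0_iff:
  assumes "f \<in> poly_space m"
  shows "fischer m f f = 0 \<longleftrightarrow> f = 0"
proof
  assume "fischer m f f = 0"
  hence "\<forall>k\<in>{..m}. (cmod (coeff f k))\<^sup>2 / real (m choose k) = 0"
    unfolding fischer_self of_real_eq_0_iff by (subst (asm) sum_nonneg_eq_0_iff) auto
  hence "\<forall>k\<le>m. coeff f k = 0" by simp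
  thus "f = 0"
    using assms by (intro poly_eqI) (metis coeff_0 coeff_eq_0 mem_Collect_eq not_le order.strict_trans1 poly_space_def)
qed (simp add: fischer_def)

text \<open>Antiunitarity: conjugation swaps the arguments, the signs square to 1, and the weights
  are invariant under \<open>k \<mapsto> m - k\<close>.\<close>

lemma fischer_sharpvee: "fischer m (sharpvee m f) (sharpvee m g) = fischer m g f"
proof -
  have "fischer m (sharpvee m f) (sharpvee m g)
      = (\<Sum>k\<le>m. coeff g (m - k) * cnj (coeff f (m - k)) / of_nat (m choose k))"
    unfolding fischer_def
    by (intro sum.cong refl) (simp add: coeff_sharpvee minus_one_power_cancel mult.commute)
  also have "\<dots> = fischer m g f"
    unfolding fischer_def
    by (rule sum.reindex_bij_witness[of _ "\<lambda>k. m - k" "\<lambda>k. m - k"]) (auto simp flip: binomial_symmetric)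
  finally show ?thesis .
qed

lemma poly_T_op_apolar:
  "poly (T_op q n f) z = apolar (n * degree q) (pcompose f q) ((q - [:z:]) ^ n)"
proof -
  have "degree (q - [:z:]) \<le> degree q" by (intro degree_diff_le) auto
  thus ?thesis
    by (simp add: poly_T_op S_op_def apolar_def sharpvee_power)
qed

text \<open>Binomial expansion of \<open>([:-z:] + q) ^ n\<close>; since the apolarity form is
  linear, not conjugate-linear, in its second argument, the powers of \<open>z\<close> come out
  without conjugation.\<close>

lemma coeff_T_op:
  assumes "k \<le> n"
  shows "coeff (T_op q n f) k
    = (-1) ^ k * of_nat (n choose k) * apolar (n * degree q) (pcompose f q) (q ^ (n - k))"
proof -
  define c where "c k = (-1) ^ k * of_nat (n choose k) * apolar (n * degree q) (pcompose f q) (q ^ (n - k))" for k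
  have "poly (T_op q n f) z = poly (\<Sum>k\<le>n. monom (c k) k) z" for z
  proof -
    have "q - [:z:] = [:-z:] + q"
      by (rule poly_eqI) (simp add: coeff_pCons split: nat.split)
    hence "(q - [:z:]) ^ n = ([:-z:] + q) ^ n" by (simp only:)
    also have "\<dots> = (\<Sum>k\<le>n. smult (of_nat (n choose k) * (-z) ^ k) (q ^ (n - k)))"
      unfolding binomial_ring by (intro sum.cong refl) (simp add: poly_const_pow of_nat_poly)
    finally have e: "(q - [:z:]) ^ n = \<dots>" .
    show ?thesis
      unfolding poly_T_op_apolar e
      by (simp add: apolar_sum_right apolar_smult_right poly_sum poly_monom c_def power_minus[of z] mult_ac)
  qed
  hence "T_op q n f = (\<Sum>k\<le>n. monom (c k) k)" by (rule poly_ext)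
  thus ?thesis using assms by (simp add: coeff_sum c_def)
qed

lemma T_op_in_poly_space: "T_op q n f \<in> poly_space n"
  using degree_T_op_le by (simp add: poly_space_def)

lemma coeff_T_op_gt: "k > n \<Longrightarrow> coeff (T_op q n f) k = 0"
  using degree_T_op_le by (metis coeff_eq_0 order.strict_trans1)

lemma T_op_add: "T_op q n (f + g) = T_op q n f + T_op q n g"
proof (rule poly_eqI)
  fix k show "coeff (T_op q n (f + g)) k = coeff (T_op q n f + T_op q n g) k"
    by (cases "k \<le> n") (simp_all add: coeff_T_op coeff_T_op_gt pcompose_add apolar_add_left algebra_simps)
qed

lemma T_op_smult: "T_op q n (smult c f) = smult c (T_op q n f)"
proof (rule poly_eqI)
  fix k show "coeff (T_op q n (smult c f)) k = coeff (smult c (T_op q n f)) k"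
    by (cases "k \<le> n") (simp_all add: coeff_T_op coeff_T_op_gt pcompose_smult apolar_smult_left algebra_simps)
qed

lemma pcompose_monom: "pcompose (monom c k) p = smult c (p ^ k)"
  for p :: "complex poly"
  by (rule poly_ext) (simp add: poly_pcompose poly_monom)

lemma poly_space_eq_sum:
  assumes "h \<in> poly_space n"
  shows "h = (\<Sum>k\<le>n. monom (coeff h k) k)"
  using poly_as_sum_of_monoms'[of h n] assms by (simp add: poly_space_def)

text \<open>The binomial coefficient in the \<open>k\<close>-th coefficient of \<open>T_op\<close>
  cancels the Fischer weight, and its sign cancels that of \<open>sharpvee\<close>. What remains is
  the expansion of \<open>pcompose h q\<close> in powers of \<open>q\<close>.\<close>

lemma fischer_T_op:
  assumes "h \<in> poly_space n"
  shows "fischer n (T_op q n f) (sharpvee n h)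
    = apolar (n * degree q) (pcompose f q) (pcompose h q)"
proof -
  let ?B = "apolar (n * degree q) (pcompose f q)"
  have "pcompose h q = (\<Sum>k\<le>n. smult (coeff h k) (q ^ k))"
    by (subst poly_space_eq_sum[OF assms])
      (simp add: pcompose_sum pcompose_monom)
  hence "?B (pcompose h q) = (\<Sum>k\<le>n. coeff h k * ?B (q ^ k))"
    by (simp add: apolar_sum_right apolar_smult_right)
  also have "\<dots> = (\<Sum>k\<le>n. coeff h (n - k) * ?B (q ^ (n - k)))"
    by (rule sum.reindex_bij_witness[of _ "\<lambda>k. n - k" "\<lambda>k. n - k"]) auto
  also have "\<dots> = fischer n (T_op q n f) (sharpvee n h)"
    unfolding fischer_def
    by (intro sum.cong refl)
      (simp add: coeff_T_op coeff_sharpvee mult.assoc[of _ "of_nat _"] minus_one_power_cancel)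
  finally show ?thesis by simp
qed

lemma poly_space_subspace: "cpoly.subspace (poly_space n)"
  by (auto simp: cpoly.subspace_def poly_space_def intro: degree_add_le)

lemma poly_space_add: "f \<in> poly_space n \<Longrightarrow> g \<in> poly_space n \<Longrightarrow> f + g \<in> poly_space n"
  and poly_space_smult: "f \<in> poly_space n \<Longrightarrow> smult c f \<in> poly_space n"
  and poly_space_diff: "f \<in> poly_space n \<Longrightarrow> g \<in> poly_space n \<Longrightarrow> f - g \<in> poly_space n"
  and poly_space_sum: "(\<And>i. i \<in> A \<Longrightarrow> h i \<in> poly_space n) \<Longrightarrow> sum h A \<in> poly_space n"
  using poly_space_subspace[of n]
  by (auto intro: cpoly.subspace_add cpoly.subspace_scale cpoly.subspace_diff cpoly.subspace_sum)

section \<open>Fischer-orthonormal bases\<close>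

text \<open>Completeness is assumed as the Fourier expansion, which makes comparison of coefficients
  immediate; spanning follows from it and independence from orthonormality.\<close>

locale fischer_basis =
  fixes n :: nat and f :: "nat \<Rightarrow> complex poly"
  assumes mem: "j \<le> n \<Longrightarrow> f j \<in> poly_space n"
    and ortho: "j \<le> n \<Longrightarrow> k \<le> n \<Longrightarrow> fischer n (f j) (f k) = (if j = k then 1 else 0)"
    and expand: "g \<in> poly_space n \<Longrightarrow> g = (\<Sum>j\<le>n. smult (fischer n g (f j)) (f j))"
begin

lemma fischer_comb:
  assumes "k \<le> n"
  shows "fischer n (\<Sum>j\<le>n. smult (c j) (f j)) (f k) = c k"
proof -
  have "fischer n (\<Sum>j\<le>n. smult (c j) (f j)) (f k) = (\<Sum>j\<le>n. if j = k then c j else 0)"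
    unfolding fischer_sum_left fischer_smult_left using assms ortho by (intro sum.cong) auto
  thus ?thesis using assms by simp
qed

lemma inj: "inj_on f {..n}"
  using ortho by (intro inj_onI) (metis atMost_iff zero_neq_one)

lemma eqI:
  assumes "g \<in> poly_space n" "h \<in> poly_space n" "\<And>k. k \<le> n \<Longrightarrow> fischer n g (f k) = fischer n h (f k)"
  shows "g = h"
  using expand[OF assms(1)] expand[OF assms(2)] assms(3) by (metis (no_types, lifting) atMost_iff sum.cong)

lemma independent: "cpoly.independent (f ` {..n})"
proof -
  have "c k = 0" if "(\<Sum>v\<in>f ` {..n}. smult (c v) v) = 0" "k \<in> f ` {..n}" for c k
  proof -
    obtain j where j: "j \<le> n" "k = f j" using \<open>k \<in> _\<close> by auto
    have "(\<Sum>j\<le>n. smult (c (f j)) (f j)) = 0"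
      using that(1) by (simp add: sum.reindex[OF inj])
    hence "c (f j) = fischer n 0 (f j)" using fischer_comb[OF j(1), of "\<lambda>j. c (f j)"] by simp
    thus ?thesis by (simp add: fischer_def j)
  qed
  thus ?thesis
    by (auto simp: cpoly.independent_explicit_module cpoly.dependent_finite)
qed

lemma span: "cpoly.span (f ` {..n}) = poly_space n"
proof
  show "cpoly.span (f ` {..n}) \<subseteq> poly_space n"
    using mem by (intro cpoly.span_minimal poly_space_subspace) auto
  show "poly_space n \<subseteq> cpoly.span (f ` {..n})"
  proof
    fix g assume "g \<in> poly_space n"
    show "g \<in> cpoly.span (f ` {..n})"
      by (subst expand[OF \<open>g \<in> _\<close>])
        (intro cpoly.span_sum cpoly.span_scale cpoly.span_base imageI)
  qed
qed

lemma basis_on: "basis_on n f"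
  using inj independent span by (simp add: basis_on_def)

lemma orthonormal_on: "orthonormal_on n f"
  using ortho by (simp add: orthonormal_on_def)

text \<open>The candidate for the modulus: \<open>f j\<close> is an eigenvector with eigenvalue
  \<open>s j\<close>.\<close>

definition diag :: "(nat \<Rightarrow> real) \<Rightarrow> complex poly \<Rightarrow> complex poly" where
  "diag s g = (\<Sum>j\<le>n. smult (complex_of_real (s j) * fischer n g (f j)) (f j))"

lemma diag_mem: "diag s g \<in> poly_space n"
  unfolding diag_def using mem by (auto intro!: poly_space_sum poly_space_smult)

lemma diag_add: "diag s (g + h) = diag s g + diag s h"
  by (simp add: diag_def fischer_add_left distrib_left smult_add_left sum.distrib)

lemma diag_smult: "diag s (smult c g) = smult c (diag s g)"
  by (simp add: diag_def fischer_smult_left cpoly.scale_sum_right mult_ac)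

lemma fischer_diag: "k \<le> n \<Longrightarrow> fischer n (diag s g) (f k) = s k * fischer n g (f k)"
  by (simp add: diag_def fischer_comb)

lemma positive_diag:
  assumes "\<And>j. s j \<ge> 0"
  shows "positive_on n (diag s)"
proof -
  have sum: "fischer n (diag s g) h
      = (\<Sum>j\<le>n. of_real (s j) * (fischer n g (f j) * cnj (fischer n h (f j))))"
    for g h
    by (simp add: diag_def fischer_sum_left fischer_smult_left fischer_commute[of n h] mult_ac)
  have "fischer n (diag s g) h = fischer n g (diag s h)" for g h
    unfolding fischer_commute[of n g "diag s h"] sum by (simp add: mult_ac)
  moreover have "operator_on n (diag s)"
    by (simp add: operator_on_def diag_mem diag_add diag_smult)
  moreover have "fischer n (diag s g) g = of_real (\<Sum>j\<le>n. s j * (cmod (fischer n g (f j)))\<^sup>2)" for g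
    unfolding sum of_real_sum of_real_mult complex_norm_square ..
  ultimately show ?thesis
    using assms by (auto simp: positive_on_def adjoint_on_def intro!: sum_nonneg)
qed

text \<open>Pairing the eigenvalue equation with \<open>f k\<close> gives
  \<open>s k * c = \<mu> * c\<close> for the coefficient \<open>c\<close> of \<open>g\<close> at
  \<open>f k\<close>, so only indices with \<open>s k = \<mu>\<close> survive in the
  expansion.\<close>

lemma eigenspace_diag:
  "{g \<in> poly_space n. diag s g = smult \<mu> g} = cpoly.span (f ` {j. j \<le> n \<and> complex_of_real (s j) = \<mu>})"
  (is "?E = cpoly.span (f ` ?J)")
proof
  have "diag s (f k) = smult (s k) (f k)" if "k \<le> n" for k
    using that by (intro eqI diag_mem poly_space_smult mem) (auto simp: fischer_diag fischer_smult_left ortho)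
  moreover have "0 \<in> ?E"
    using diag_smult[of s 0 0] by (simp add: poly_space_def)
  hence "cpoly.subspace ?E"
    unfolding cpoly.subspace_def
    by (auto simp: poly_space_add poly_space_smult diag_add diag_smult smult_add_right mult.commute)
  ultimately show "cpoly.span (f ` ?J) \<subseteq> ?E"
    using mem by (intro cpoly.span_minimal) auto
  show "?E \<subseteq> cpoly.span (f ` ?J)"
  proof
    fix g assume "g \<in> ?E"
    hence g: "g \<in> poly_space n" "diag s g = smult \<mu> g" by auto
    have "fischer n g (f k) = 0" if "k \<le> n" "complex_of_real (s k) \<noteq> \<mu>" for k
      using fischer_diag[OF that(1), of s g] that(2) by (simp add: g(2) fischer_smult_left)
    hence "g = (\<Sum>j\<in>?J. smult (fischer n g (f j)) (f j))"
      by (subst expand[OF g(1)], intro sum.mono_neutral_right) auto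
    moreover have "\<dots> \<in> cpoly.span (f ` ?J)"
      by (intro cpoly.span_sum cpoly.span_scale cpoly.span_base imageI)
    ultimately show "g \<in> cpoly.span (f ` ?J)" by simp
  qed
qed

lemma dim_eigenspace_diag:
  "cpoly.dim {g \<in> poly_space n. diag s g = smult \<mu> g} = card {j. j \<le> n \<and> complex_of_real (s j) = \<mu>}"
proof -
  let ?J = "{j. j \<le> n \<and> complex_of_real (s j) = \<mu>}"
  have J: "?J \<subseteq> {..n}" by auto
  have "cpoly.independent (f ` ?J)"
    by (rule cpoly.independent_mono[OF independent image_mono[OF J]])
  thus ?thesis
    unfolding eigenspace_diag
    by (simp add: cpoly.dim_eq_card_independent card_image[OF inj_on_subset[OF inj J]])
qed

text \<open>The hypothesis \<open>AA\<close> expresses \<open>A\<^sup>* A (f k) = (s k)\<^sup>2 (f k)\<close> without referring to the adjoint.\<close>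

lemma singular_values_onI:
  assumes A: "operator_on n A" and s: "\<And>j. s j \<ge> 0"
    and AA: "\<And>g k. g \<in> poly_space n \<Longrightarrow> k \<le> n \<Longrightarrow>
      fischer n (A g) (A (f k)) = of_real ((s k)\<^sup>2) * fischer n g (f k)"
  shows "singular_values_on n A s"
proof -
  \<comment> \<open>The adjoint of \<open>A\<close>, prescribed by its coefficients: that of
    \<open>B g\<close> at \<open>f j\<close> must be the product of \<open>g\<close> with
    \<open>A (f j)\<close>.\<close>
  define B where "B g = (\<Sum>j\<le>n. smult (fischer n g (A (f j))) (f j))" for g
  have A_mem: "A g \<in> poly_space n" if "g \<in> poly_space n" for g
    using A that by (simp add: operator_on_def)
  have A_sum: "A (\<Sum>j\<in>J. smult (c j) (f j)) = (\<Sum>j\<in>J. smult (c j) (A (f j)))"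
    if "finite J" "J \<subseteq> {..n}" for J c
    using that
  proof (induction J rule: finite_induct)
    case empty
    have "A (smult 0 0) = smult 0 (A 0)"
      using A unfolding operator_on_def by (metis degree_0 mem_Collect_eq poly_space_def zero_le)
    thus ?case by simp
  next
    case (insert j J)
    have "(\<Sum>j\<in>J. smult (c j) (f j)) \<in> poly_space n" "f j \<in> poly_space n"
      using insert.prems mem by (auto intro!: poly_space_sum poly_space_smult)
    thus ?case
      using insert A by (simp add: operator_on_def poly_space_smult)
  qed
  have B_mem: "B g \<in> poly_space n" for g
    unfolding B_def using mem by (auto intro!: poly_space_sum poly_space_smult)
  have "operator_on n B"
    unfolding operator_on_def using B_mem
    by (auto simp: B_def fischer_add_left fischer_smult_left smult_add_left sum.distrib cpoly.scale_sum_right)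
  moreover have "fischer n (A g) h = fischer n g (B h)" if "g \<in> poly_space n" for g h
  proof -
    have "fischer n (A g) h = (\<Sum>j\<le>n. fischer n g (f j) * fischer n (A (f j)) h)"
      by (subst expand[OF that]) (simp add: A_sum fischer_sum_left fischer_smult_left)
    also have "\<dots> = fischer n g (B h)"
      by (simp add: B_def fischer_sum_right fischer_smult_right fischer_commute[of n h] mult_ac)
    finally show ?thesis .
  qed
  ultimately have "adjoint_on n A B" by (simp add: adjoint_on_def)
  \<comment> \<open>Both sides have the coefficient \<open>(s k)\<^sup>2 * fischer n g (f k)\<close>
    at \<open>f k\<close>, the right one by \<open>AA\<close>.\<close>
  moreover have "diag s (diag s g) = B (A g)" if "g \<in> poly_space n" for g
    using that by (intro eqI diag_mem B_mem)
      (simp add: fischer_diag, simp add: B_def fischer_comb AA power2_eq_square)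
  ultimately have "modulus_on n A (diag s)"
    using positive_diag[OF s] by (auto simp: modulus_on_def)
  thus ?thesis
    unfolding singular_values_on_def dim_eigenspace_diag[symmetric] using A by blast
qed

end

text \<open>The monomial of degree \<open>k\<close> has squared Fischer norm
  \<open>1 / (n choose k)\<close>. Scaled by the square root of the binomial coefficient, the
  monomials are orthonormal, so passing from coordinates to polynomials is unitary.\<close>

lemma fischer_basis_of_orthonormal_family:
  assumes u: "orthonormal_family {..n} (Suc n) u"
  defines "f \<equiv> \<lambda>j. \<Sum>k\<le>n. monom (u j k * of_real (sqrt (real (n choose k)))) k"
  shows "fischer_basis n f"
proof
  let ?w = "\<lambda>k. complex_of_real (sqrt (real (n choose k)))"
  have ww: "?w k * ?w k = of_nat (n choose k)" for k
    by (simp flip: of_real_mult)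
  have coeff: "coeff (f j) k = (if k \<le> n then u j k * ?w k else 0)" for j k
    by (simp add: f_def coeff_sum)
  show mem: "f j \<in> poly_space n" for j
    by (auto simp: poly_space_def coeff intro!: degree_le)
  show "fischer n (f j) (f k) = (if j = k then 1 else 0)" if "j \<le> n" "k \<le> n" for j k
  proof -
    have "fischer n (f j) (f k) = herm {..n} (u j) (u k)"
      unfolding fischer_def herm_def
    proof (intro sum.cong refl)
      fix i assume "i \<in> {..n}"
      hence "coeff (f j) i * cnj (coeff (f k) i) = u j i * cnj (u k i) * of_nat (n choose i)"
        by (simp add: coeff mult_ac flip: ww)
      thus "coeff (f j) i * cnj (coeff (f k) i) / of_nat (n choose i) = u j i * cnj (u k i)"
        using \<open>i \<in> {..n}\<close> by simp
    qed
    thus ?thesis using u that by (simp add: orthonormal_family_def)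
  qed
  show "g = (\<Sum>j\<le>n. smult (fischer n g (f j)) (f j))" if g: "g \<in> poly_space n" for g
  proof (rule poly_eqI)
    fix i
    show "coeff g i = coeff (\<Sum>j\<le>n. smult (fischer n g (f j)) (f j)) i"
    proof (cases "i \<le> n")
      case True
      have "coeff (\<Sum>j\<le>n. smult (fischer n g (f j)) (f j)) i
        = (\<Sum>j\<le>n. \<Sum>k\<le>n. coeff g k * ?w k * ?w i / of_nat (n choose k) * (cnj (u j k) * u j i))"
        using True by (simp add: coeff_sum coeff fischer_def sum_distrib_left mult_ac)
      also have "\<dots> = (\<Sum>k\<le>n. coeff g k * ?w k * ?w i / of_nat (n choose k) * (\<Sum>j\<le>n. cnj (u j k) * u j i))"
        by (subst sum.swap) (simp add: sum_distrib_left)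
      \<comment> \<open>Orthonormality of the columns collapses the inner sum.\<close>
      also have "\<dots> = (\<Sum>k\<le>n. if i = k then coeff g k * ?w k * ?w k / of_nat (n choose k) else 0)"
        using orthonormal_family_complete[of "{..n}" u] u True
        by (intro sum.cong) (auto simp: lessThan_Suc_atMost)
      also have "\<dots> = coeff g i"
        using True ww[of i] by (simp add: mult.assoc)
      finally show ?thesis ..
    next
      case False
      thus ?thesis using g by (simp add: coeff_sum coeff poly_space_def coeff_eq_0)
    qed
  qed
qed

section \<open>Diagonalisation of the pulled-back apolarity form\<close>

theorem corollary4p4:
  fixes q :: "complex poly" and n :: nat
  assumes monic: "lead_coeff q = 1"
    and even_degree: "even (degree q)"
  shows "\<exists>(f :: nat \<Rightarrow> complex poly) (sv :: nat \<Rightarrow> real).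
    basis_on n f \<and> orthonormal_on n f \<and>
    singular_values_on n (T_op q n) sv \<and>
    (\<forall>j\<le>n. \<forall>k\<le>n. apolar (n * degree q) (pcompose (f j) q) (pcompose (f k) q)
        = (if j = k then complex_of_real (sv j) else 0))"
proof -
  let ?N = "n * degree q"
  let ?B = "\<lambda>g h. apolar ?N (pcompose g q) (pcompose h q)"
  let ?J = "sharpvee n" and ?T = "T_op q n"
  let ?w = "\<lambda>k. complex_of_real (sqrt (real (n choose k)))"
  \<comment> \<open>The Gram matrix of \<open>?B\<close> in the orthonormal scaled
    monomials.\<close>
  define M where "M a b = ?w a * ?w b * apolar ?N (q ^ a) (q ^ b)" for a b
  have comm: "apolar ?N g h = apolar ?N h g" for g h
    using even_degree by (intro apolar_commute) simp
  hence sym: "M a b = M b a" for a b by (simp add: M_def mult_ac)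
  obtain u s where us: "orthonormal_family {..n} (Suc n) u" "\<And>j. s j \<ge> 0"
    "\<And>i j. i < Suc n \<Longrightarrow> j < Suc n \<Longrightarrow> bilf {..n} M (u i) (u j) = (if i = j then complex_of_real (s j) else 0)"
    by (rule takagi[OF finite_atMost, of n M, unfolded card_atMost]) (use sym in blast)+
  define f where "f j = (\<Sum>k\<le>n. monom (u j k * ?w k) k)" for j
  interpret fischer_basis n f
    unfolding f_def by (rule fischer_basis_of_orthonormal_family[OF us(1)])
  have f_q: "pcompose (f j) q = (\<Sum>k\<le>n. smult (u j k * ?w k) (q ^ k))" for j
    by (simp add: f_def pcompose_sum pcompose_monom)
  have "?B (f i) (f j) = bilf {..n} M (u i) (u j)" for i j
    unfolding f_q apolar_sum_left apolar_smult_left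
    unfolding apolar_sum_right apolar_smult_right bilf_def M_def sum_distrib_left
    by (intro sum.cong refl) (simp only: mult_ac)
  hence B: "?B (f i) (f j) = (if i = j then complex_of_real (s j) else 0)" if "i \<le> n" "j \<le> n" for i j
    using us(3) that by simp
  have op: "operator_on n ?T"
    by (simp add: operator_on_def T_op_in_poly_space T_op_add T_op_smult)
  have B_right: "?B g (f k) = of_real (s k) * fischer n g (f k)" if "g \<in> poly_space n" "k \<le> n" for g k
  proof -
    have "?B g (f k) = (\<Sum>j\<le>n. fischer n g (f j) * ?B (f j) (f k))"
      by (subst expand[OF that(1)])
        (simp add: pcompose_sum pcompose_smult apolar_sum_left apolar_smult_left)
    also have "\<dots> = (\<Sum>j\<le>n. if j = k then fischer n g (f k) * of_real (s k) else 0)"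
      using that by (intro sum.cong) (auto simp: B)
    finally show ?thesis using that by (simp add: mult_ac)
  qed
  have T_f: "?T (f k) = smult (of_real (s k)) (?J (f k))" if "k \<le> n" for k
  proof -
    define e where "e = ?T (f k) - smult (of_real (s k)) (?J (f k))"
    have e: "e \<in> poly_space n"
      unfolding e_def by (intro poly_space_diff poly_space_smult T_op_in_poly_space sharpvee_in_poly_space)
    \<comment> \<open>Both parts of \<open>e\<close> have the same product with \<open>?J h\<close>:
      for \<open>?T (f k)\<close> it is \<open>?B (f k) h\<close>, and for the other part
      antiunitarity gives \<open>s k * fischer n h (f k)\<close>. Taking \<open>h = ?J e\<close>
      then yields \<open>e = 0\<close>, as \<open>?J (?J e)\<close> is \<open>e\<close> up to
      sign.\<close>
    have "fischer n e (?J h) = 0" if h: "h \<in> poly_space n" for h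
      using B_right[OF h \<open>k \<le> n\<close>]
      by (simp add: e_def fischer_diff_left fischer_smult_left fischer_T_op[OF h] fischer_sharpvee
          comm[of "pcompose (f k) q"])
    from this[of "?J e"] have "fischer n e e = 0"
      by (simp add: sharpvee_in_poly_space sharpvee_sharpvee[OF e] fischer_smult_right)
    thus ?thesis
      using fischer_self_eq_0_iff[OF e] by (simp add: e_def)
  qed
  have "singular_values_on n ?T s"
    using op us(2)
    \<comment> \<open>One factor \<open>s k\<close> comes from \<open>T_f\<close>, the other from
      \<open>B_right\<close> applied to
      \<open>fischer n (?T g) (?J (f k)) = ?B g (f k)\<close>.\<close>
    by (rule singular_values_onI)
      (simp add: T_f fischer_smult_right fischer_T_op mem B_right power2_eq_square)
  thus ?thesis
    using B basis_on orthonormal_on by (intro exI[of _ f] exI[of _ s]) simp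
qed

end
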